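(* Let $a\in\mathbb{N}$ and $b\in\mathbb{Z}$ be such that $an+b\ge 0$ for all $n\in\mathbb{N}$, and let $f_{a,b}(n)=an+b$. Then: (i) If $a$ and $b$ are even, $$\mathbb{N}\setminus\mathcal{M}_{f_{a,b}}=2\mathbb{N}\ \cup\bigcup_{p\in\mathcal{P}_{a,b}}\left\{\Xi(a,b,p)+\frac{s}{a}\,\mathrm{lcm}(ap,p-1): s\in\mathbb{Z},\ s\ge 0\right\}.$$ (ii) If $a$ and $b$ are odd, $$\mathbb{N}\setminus\mathcal{M}_{f_{a,b}}=\{n\in\mathbb{N}: n\equiv 2\ (\mathrm{mod}\ 4)\}\ \cup\bigcup_{p\in\mathcal{P}_{a,b}}\left\{\Xi(a,b,p)+\frac{s}{a}\,\mathrm{lcm}(ap,p-1): s\in\mathbb{Z},\ s\ge 0\right\}.$$ (iii) If $a$ is even and $b$ is odd, then $\mathbb{N}\setminus\mathcal{M}_{f_{a,b}}=\{n\in\mathbb{N}: n\equiv 2\ (\mathrm{mod}\ 4)\}$. (iv) If $a$ is odd and $b$ is even, then $\mathbb{N}\setminus\mathcal{M}_{f_{a,b}}=2\mathbb{N}$.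
   Context: $\mathbb{N}$ denotes the set of positive integers and $2\mathbb{N}$ the positive even integers. For an integer $k\ge 0$ and $n\in\mathbb{N}$, $S_k(n):=\sum_{j=1}^n j^k$. For a function $f$ on $\mathbb{N}$ with non-negative integer values, $\mathcal{M}_f:=\{n\in\mathbb{N}: n \text{ divides } S_{f(n)}(n)\}$. For $(a,b)\in\mathbb{N}\times\mathbb{Z}$, $$\mathcal{P}_{a,b}:=\{p \text{ odd prime}: b\equiv 0\ (\mathrm{mod}\ \gcd(ap,p-1))\},$$ and for $p\in\mathcal{P}_{a,b}$, $$\Xi(a,b,p):=a^{-1}\min\{x\in\mathbb{N}: x\equiv 0\ (\mathrm{mod}\ ap),\ x\equiv -b\ (\mathrm{mod}\ p-1)\}.$$ *)

theory Defs
  imports Complex_Main "HOL-Number_Theory.Cong"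
begin

definition power_sum :: "nat \<Rightarrow> nat \<Rightarrow> nat" where
  "power_sum k n = (\<Sum>j=1..n. j ^ k)"

(* Only the values of f at positive arguments matter. *)
definition M_set :: "(nat \<Rightarrow> nat) \<Rightarrow> nat set" where
  "M_set f = {n. 0 < n \<and> n dvd power_sum (f n) n}"

(* Truncation by nat is harmless at arguments n
   for which a n + b is non-negative. *)
definition lin_fun :: "nat \<Rightarrow> int \<Rightarrow> nat \<Rightarrow> nat" where
  "lin_fun a b n = nat (int a * int n + b)"

definition P_set :: "nat \<Rightarrow> int \<Rightarrow> nat set" where
  "P_set a b = {p. prime p \<and> odd p \<and> [b = 0] (mod int (gcd (a * p) (p - 1)))}"

(* For p in P_set a b and a > 0 the two congruences are simultaneously solvable,
   so that the LEAST is a genuine minimum. *)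
definition Xi :: "nat \<Rightarrow> int \<Rightarrow> nat \<Rightarrow> real" where
  "Xi a b p =
     inverse (real a) *
     real (LEAST x::nat. 0 < x \<and> [x = 0] (mod (a * p)) \<and> [int x = - b] (mod int (p - 1)))"

(* A set of reals, so that the integrality of
   its elements is not built into the definition. *)
definition Xi_progression :: "nat \<Rightarrow> int \<Rightarrow> nat \<Rightarrow> real set" where
  "Xi_progression a b p =
     {Xi a b p + real s / real a * real (lcm (a * p) (p - 1)) | s :: nat. True}"

end

theory Submission
  imports Defs "HOL-Number_Theory.Residue_Primitive_Roots"
begin

text \<open>
  Write \<open>S\<^sub>k(n)\<close> for the sum of the first \<open>n\<close> positive \<open>k\<close>-th powers. Whether \<open>n\<close> divides
  \<open>S\<^sub>k(n)\<close> depends on the parity of \<open>k\<close>.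

  For even \<open>k > 0\<close>, cut the range into blocks whose length is the exact power \<open>p\<^sup>e\<close> of a prime \<open>p\<close> in
  \<open>n\<close>: modulo \<open>p\<^sup>e\<close> the sum \<open>S\<^sub>k(n)\<close> is a multiple, by a number prime to \<open>p\<close>, of \<open>S\<^sub>k(p\<^sup>e)\<close>. A
  first-order binomial expansion shows \<open>S\<^sub>k(pm) \<equiv> p S\<^sub>k(m)\<close> modulo \<open>pm\<close> when \<open>p\<close> divides \<open>m\<close>, so
  that \<open>p\<^sup>e\<close> divides \<open>S\<^sub>k(p\<^sup>e)\<close> exactly when \<open>p\<close> divides \<open>S\<^sub>k(p)\<close>. By Fermat and the existence of
  primitive roots, \<open>S\<^sub>k(p)\<close> is \<open>-1\<close> modulo \<open>p\<close> if \<open>p - 1\<close> divides \<open>k\<close>, and \<open>0\<close> otherwise. Hence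
  \<open>n\<close> divides \<open>S\<^sub>k(n)\<close> iff no prime \<open>p\<close> dividing \<open>n\<close> has \<open>p - 1\<close> dividing \<open>k\<close>
  (\<open>dvd_power_sum_even_iff\<close>). The prime \<open>2\<close> always violates this, so every even \<open>n\<close> fails.

  For odd \<open>k\<close>, pairing \<open>j\<close> with \<open>n - j\<close> cancels everything modulo \<open>n\<close> except, for even \<open>n\<close>, the
  middle term \<open>(n/2)\<^sup>k\<close>. So exactly the \<open>n \<equiv> 2\<close> modulo \<open>4\<close> fail (\<open>dvd_power_sum_odd_iff\<close>); only
  \<open>k = 1\<close> with \<open>4\<close> dividing \<open>n\<close> behaves differently.

  Now put \<open>k = a n + b\<close>. Since \<open>a + b \<ge> 0\<close>, we have \<open>k \<ge> n - 1\<close>, so the degenerate exponents \<open>0\<close>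
  and \<open>1\<close> occur only for \<open>n \<le> 2\<close> and do no harm. The parities of \<open>a\<close>, \<open>b\<close> and \<open>n\<close> decide which
  criterion applies. The failures caused by an odd prime \<open>p\<close> are the \<open>n\<close> with \<open>p\<close> dividing \<open>n\<close> and
  \<open>p - 1\<close> dividing \<open>a n + b\<close>; in terms of \<open>x = a n\<close> these are two simultaneous congruences, and
  the Chinese remainder theorem for moduli that need not be coprime turns their solutions into one
  arithmetic progression, which is nonempty precisely for the primes in \<open>P_set a b\<close>
  (\<open>Union_Xi_progression_eq\<close>).
\<close>

section \<open>Power sums over blocks\<close>

lemma power_sum_blocks:
  "power_sum k (q * d) = (\<Sum>i<q. \<Sum>j=1..d. (i * d + j) ^ k)"
proof (induction q)
  case 0
  then show ?case by (simp add: power_sum_def)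
next
  case (Suc q)
  have "power_sum k (Suc q * d) = (\<Sum>j=1..q*d+d. j ^ k)"
    by (simp add: power_sum_def add.commute)
  also have "\<dots> = (\<Sum>j=1..q*d. j ^ k) + (\<Sum>j=q*d+1..q*d+d. j ^ k)"
    by (rule sum.ub_add_nat) simp
  also have "(\<Sum>j=q*d+1..q*d+d. j ^ k) = (\<Sum>j=1..d. (q * d + j) ^ k)"
    using sum.shift_bounds_cl_nat_ivl[of "\<lambda>j. j ^ k" 1 "q * d" d] by (simp add: add.commute)
  finally show ?case using Suc by (simp add: power_sum_def)
qed

lemma power_sum_mult_cong: "[power_sum k (q * d) = q * power_sum k d] (mod d)"
proof -
  have "[(\<Sum>i<q. \<Sum>j=1..d. (i * d + j) ^ k) = (\<Sum>i<q. \<Sum>j=1..d. j ^ k)] (mod d)"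
    by (intro cong_sum cong_pow) (simp add: cong_def)
  then show ?thesis by (simp add: power_sum_blocks) (simp add: power_sum_def)
qed

text \<open>
  The binomial expansion to first order, for use with steps \<open>i * m\<close>.
\<close>

lemma power_add_cong_square:
  fixes i m j :: nat
  shows "[(i * m + j) ^ k = j ^ k + k * i * m * j ^ (k - 1)] (mod m\<^sup>2)"
proof (induction k)
  case (Suc k)
  have "[(i * m + j) ^ Suc k = (i * m + j) * (j ^ k + k * i * m * j ^ (k - 1))] (mod m\<^sup>2)"
    using Suc by (simp add: cong_scalar_left)
  also have "(i * m + j) * (j ^ k + k * i * m * j ^ (k - 1)) =
      j ^ Suc k + Suc k * i * m * j ^ k + m\<^sup>2 * (k * i\<^sup>2 * j ^ (k - 1))"
    by (cases k) (simp_all add: algebra_simps power2_eq_square)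
  also have "[\<dots> = j ^ Suc k + Suc k * i * m * j ^ k] (mod m\<^sup>2)"
    by (simp add: cong_def)
  finally show ?case by simp
qed simp

text \<open>
  The range up to \<open>p * m\<close> consists of \<open>p\<close> blocks of length \<open>m\<close>. The linear terms of the expansions of
  \<open>(i * m + j) ^ k\<close> add up to a multiple of \<open>m * k * (\<Sum>i<p. i)\<close>, and \<open>k * (\<Sum>i<p. i)\<close> is
  \<open>p * (k * (p - 1) / 2)\<close>, where one of \<open>k\<close> and \<open>p - 1\<close> is even. The quadratic terms vanish
  because \<open>p * m\<close> divides \<open>m\<^sup>2\<close>.
\<close>

lemma power_sum_lift_cong:
  assumes "p dvd m" and "odd p \<or> even k"
  shows "[power_sum k (p * m) = p * power_sum k m] (mod (p * m))"
proof -
  define T where "T = (\<Sum>j=1..m. j ^ (k - 1))"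
  have gauss: "2 * (\<Sum>i<p. i) = p * (p - 1)"
  proof (induction p)
    case (Suc p)
    then show ?case by (cases p) (simp_all add: algebra_simps)
  qed simp
  have p_dvd: "p dvd k * (\<Sum>i<p. i)"
  proof (cases "odd p")
    case True
    then have "coprime p 2" by simp
    then have "p dvd (\<Sum>i<p. i)"
      using gauss by (metis coprime_dvd_mult_right_iff dvd_triv_left)
    then show ?thesis by simp
  next
    case False
    then obtain c where "k = 2 * c" using assms by auto
    then have "k * (\<Sum>i<p. i) = c * (2 * (\<Sum>i<p. i))" by simp
    then have "k * (\<Sum>i<p. i) = c * (p * (p - 1))" by (simp only: gauss)
    then show ?thesis by simp
  qed
  have "[power_sum k (p * m) =
      (\<Sum>i<p. \<Sum>j=1..m. j ^ k + k * i * m * j ^ (k - 1))] (mod m\<^sup>2)"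
    unfolding power_sum_blocks by (intro cong_sum power_add_cong_square)
  then have "[power_sum k (p * m) =
      (\<Sum>i<p. \<Sum>j=1..m. j ^ k + k * i * m * j ^ (k - 1))] (mod (p * m))"
    by (rule cong_dvd_modulus_nat) (use assms(1) in \<open>simp add: power2_eq_square\<close>)
  also have "(\<Sum>i<p. \<Sum>j=1..m. j ^ k + k * i * m * j ^ (k - 1)) =
      (\<Sum>i<p. power_sum k m + k * i * m * T)"
    by (simp add: sum.distrib power_sum_def T_def sum_distrib_left)
  also have "\<dots> = p * power_sum k m + k * (\<Sum>i<p. i) * m * T"
    by (simp add: sum.distrib sum_distrib_left sum_distrib_right)
  also have "[\<dots> = p * power_sum k m] (mod (p * m))"
  proof -
    have "p * m dvd k * (\<Sum>i<p. i) * m * T"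
      by (intro dvd_mult2 mult_dvd_mono p_dvd dvd_refl)
    then show ?thesis by (simp only: cong_add_lcancel_0_nat cong_0_iff)
  qed
  finally show ?thesis .
qed

text \<open>
  Lifting multiplies both the modulus and the power sum by \<open>p\<close>, so divisibility is decided at \<open>e = 0\<close>.
\<close>

lemma power_dvd_power_sum_power_iff:
  assumes "0 < p" and "odd p \<or> even k"
  shows "p ^ Suc e dvd power_sum k (p ^ Suc e) \<longleftrightarrow> p dvd power_sum k p"
proof (induction e)
  case (Suc e)
  have "p ^ Suc (Suc e) dvd power_sum k (p ^ Suc (Suc e)) \<longleftrightarrow>
        p * p ^ Suc e dvd p * power_sum k (p ^ Suc e)"
    using cong_dvd_iff[OF power_sum_lift_cong[of p "p ^ Suc e" k]] assms(2) by simp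
  also have "\<dots> \<longleftrightarrow> p ^ Suc e dvd power_sum k (p ^ Suc e)"
    using assms(1) by simp
  finally show ?case using Suc by simp
qed simp

section \<open>Even exponents\<close>

text \<open>
  If \<open>p - 1\<close> divides \<open>k\<close>, each of the \<open>p - 1\<close> units contributes \<open>1\<close> by Fermat. Otherwise
  multiplication by a primitive root \<open>g\<close> permutes the residues and multiplies the sum by
  \<open>g ^ k\<close>, which is not \<open>1\<close>; so the sum is \<open>0\<close>.
\<close>

lemma prime_dvd_power_sum_prime_iff:
  assumes p: "prime p" and "0 < k"
  shows "p dvd power_sum k p \<longleftrightarrow> \<not> (p - 1) dvd k"
proof -
  have p1: "p > 1" using p by (rule prime_gt_1_nat)
  have units: "power_sum k p = (\<Sum>j=1..p-1. j ^ k) + p ^ k"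
    using p1 by (cases p) (simp_all add: power_sum_def)
  have p_dvd_pk: "p dvd p ^ k" using assms by simp
  show ?thesis
  proof (cases "(p - 1) dvd k")
    case True
    then obtain c where c: "k = (p - 1) * c" ..
    have "[j ^ k = 1] (mod p)" if "j \<in> {1..p-1}" for j
    proof -
      have "\<not> p dvd j" using that by (auto dest: dvd_imp_le)
      then have "[j ^ (p - 1) = 1] (mod p)" using p fermat_theorem by blast
      then have "[(j ^ (p - 1)) ^ c = 1 ^ c] (mod p)" by (rule cong_pow)
      then show ?thesis by (simp add: c power_mult)
    qed
    then have "[(\<Sum>j=1..p-1. j ^ k) = (\<Sum>j=1..p-1. 1)] (mod p)" by (rule cong_sum)
    then have "p dvd (\<Sum>j=1..p-1. j ^ k) \<longleftrightarrow> p dvd p - 1"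
      using cong_dvd_iff by fastforce
    moreover have "\<not> p dvd p - 1" using p1 by (auto dest: dvd_imp_le)
    ultimately show ?thesis
      using True units p_dvd_pk by (simp add: dvd_add_left_iff)
  next
    case False
    obtain g where g: "residue_primroot p g"
      using prime_primitive_root_exists[OF p1 p] by blast
    have cop: "coprime p g" and ord: "ord p g = p - 1"
      using g p by (auto simp: residue_primroot_def totient_prime)
    have inj: "inj_on (\<lambda>j. g * j mod p) {..<p}"
    proof (rule inj_onI)
      fix x y assume xy: "x \<in> {..<p}" "y \<in> {..<p}" "g * x mod p = g * y mod p"
      then have "[x = y] (mod p)"
        using cop by (simp add: cong_mult_lcancel_nat coprime_commute flip: cong_def)
      then show "x = y" using xy by (simp add: cong_def)
    qed
    have bij: "bij_betw (\<lambda>j. g * j mod p) {..<p} {..<p}"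
      unfolding bij_betw_def using p1 by (intro conjI inj endo_inj_surj) auto
    define S where "S = (\<Sum>j<p. j ^ k)"
    have "S = (\<Sum>j<p. (g * j mod p) ^ k)"
      unfolding S_def using sum.reindex_bij_betw[OF bij, of "\<lambda>j. j ^ k"] by simp
    also have "[\<dots> = (\<Sum>j<p. (g * j) ^ k)] (mod p)"
      by (intro cong_sum cong_pow) simp
    also have "(\<Sum>j<p. (g * j) ^ k) = g ^ k * S"
      by (simp add: S_def power_mult_distrib sum_distrib_left)
    finally have "[int S * 1 = int S * int g ^ k] (mod int p)"
      by (metis cong_int_iff mult.commute mult.right_neutral of_nat_mult of_nat_power)
    then have "int p dvd int S * (int g ^ k - 1)"
      by (metis cong_iff_dvd_diff cong_sym right_diff_distrib)
    moreover have "\<not> int p dvd int g ^ k - 1"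
    proof -
      have "\<not> [g ^ k = 1] (mod p)" using False ord by (simp add: ord_divides')
      then show ?thesis
        by (metis cong_iff_dvd_diff cong_int_iff of_nat_1 of_nat_power)
    qed
    moreover have "prime (int p)" using p by simp
    ultimately have "p dvd S" using prime_dvd_mult_iff int_dvd_int_iff by blast
    moreover have "power_sum k p = S + p ^ k"
    proof -
      have "(\<Sum>j<p. j ^ k) = (\<Sum>j=1..p-1. j ^ k)"
        by (rule sum.mono_neutral_right) (use \<open>0 < k\<close> p1 in auto)
      then show ?thesis by (simp add: units S_def)
    qed
    ultimately show ?thesis using False p_dvd_pk by simp
  qed
qed

text \<open>
  Divisibility by \<open>n\<close> is tested at each exact prime power \<open>q\<close> of \<open>n\<close>. The cofactor of \<open>q\<close> in \<open>n\<close> is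
  coprime to \<open>q\<close>, so the test reduces to \<open>power_sum k q\<close> and by lifting to \<open>power_sum k p\<close>. Evenness
  of \<open>k\<close> lets the lifting include \<open>p = 2\<close>.
\<close>

lemma dvd_power_sum_even_iff:
  assumes "0 < n" and "0 < k" and "even k"
  shows "n dvd power_sum k n \<longleftrightarrow> (\<forall>p. prime p \<longrightarrow> p dvd n \<longrightarrow> \<not> (p - 1) dvd k)"
proof -
  have prime_part: "p ^ multiplicity p n dvd power_sum k n \<longleftrightarrow> \<not> (p - 1) dvd k"
    if p: "prime p" "p dvd n" for p
  proof -
    obtain m where m: "n = p ^ multiplicity p n * m" "\<not> p dvd m"
      using multiplicity_decompose'[of n p] assms p not_prime_unit by blast
    define q where "q = p ^ multiplicity p n"
    obtain e where e: "multiplicity p n = Suc e"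
      using p assms by (metis prime_multiplicity_gt_zero_iff
          not0_implies_Suc prime_imp_prime_elem neq0_conv)
    have n: "n = m * q" using m q_def by (simp add: mult.commute)
    have "coprime m q"
      using p m by (simp add: q_def prime_imp_coprime coprime_commute[of m])
    have "q dvd power_sum k n \<longleftrightarrow> q dvd m * power_sum k q"
      unfolding n by (rule cong_dvd_iff[OF power_sum_mult_cong])
    also have "\<dots> \<longleftrightarrow> q dvd power_sum k q"
      using \<open>coprime m q\<close> by (simp add: coprime_dvd_mult_right_iff coprime_commute)
    also have "\<dots> \<longleftrightarrow> p dvd power_sum k p"
      unfolding q_def e using power_dvd_power_sum_power_iff p assms by (simp add: prime_gt_0_nat)
    finally show ?thesis
      using p assms by (simp add: q_def prime_dvd_power_sum_prime_iff)
  qed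
  have "power_sum k n \<noteq> 0"
    using assms by (auto simp: power_sum_def intro!: bexI[of _ 1])
  have "n dvd power_sum k n \<longleftrightarrow> (\<forall>p. prime p \<longrightarrow> p dvd n \<longrightarrow> p ^ multiplicity p n dvd power_sum k n)"
  proof
    assume "n dvd power_sum k n"
    then show "\<forall>p. prime p \<longrightarrow> p dvd n \<longrightarrow> p ^ multiplicity p n dvd power_sum k n"
      using multiplicity_dvd dvd_trans by blast
  next
    assume *: "\<forall>p. prime p \<longrightarrow> p dvd n \<longrightarrow> p ^ multiplicity p n dvd power_sum k n"
    show "n dvd power_sum k n"
    proof (rule multiplicity_le_imp_dvd)
      fix p :: nat assume p: "prime p"
      show "multiplicity p n \<le> multiplicity p (power_sum k n)"
      proof (cases "p dvd n")
        case True
        then show ?thesis using * p \<open>power_sum k n \<noteq> 0\<close>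
          by (intro multiplicity_geI) (auto simp: not_prime_unit)
      qed (simp add: not_dvd_imp_multiplicity_0)
    qed (use assms in simp)
  qed
  then show ?thesis using prime_part by blast
qed

section \<open>Odd exponents\<close>

lemma odd_power_add_dvd:
  fixes x y :: nat
  assumes "odd k"
  shows "x + y dvd x ^ k + y ^ k"
proof -
  have "[int x ^ k = (- int y) ^ k] (mod int (x + y))"
    by (intro cong_pow) (simp add: cong_iff_dvd_diff)
  then have "int (x + y) dvd int (x ^ k + y ^ k)"
    using assms by (simp add: cong_iff_dvd_diff)
  then show ?thesis by (simp only: int_dvd_int_iff)
qed

text \<open>
  Adding the sum to its reversal pairs \<open>j\<close> with \<open>n - j\<close>, which shows that \<open>n\<close> divides twice the sum;
  for odd \<open>n\<close> the factor \<open>2\<close> is harmless.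
\<close>

lemma odd_dvd_power_sum_odd:
  assumes "odd k" and "odd n"
  shows "n dvd power_sum k n"
proof -
  have "2 * (\<Sum>j\<le>n. j ^ k) = (\<Sum>j\<le>n. j ^ k + (n - j) ^ k)"
    using sum.nat_diff_reindex[of "\<lambda>j. j ^ k" "Suc n"]
    by (simp add: sum.distrib lessThan_Suc_atMost)
  moreover have "n dvd (\<Sum>j\<le>n. j ^ k + (n - j) ^ k)"
  proof (rule dvd_sum)
    fix j assume "j \<in> {..n}"
    then show "n dvd j ^ k + (n - j) ^ k"
      using odd_power_add_dvd[OF assms(1), of j "n - j"] by simp
  qed
  moreover have "(\<Sum>j\<le>n. j ^ k) = power_sum k n"
    unfolding power_sum_def by (rule sum.mono_neutral_right) (use assms(1) in \<open>auto simp: odd_pos\<close>)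
  moreover have "coprime n 2" using assms by simp
  ultimately show ?thesis by (metis coprime_dvd_mult_right_iff)
qed

text \<open>
  For an even upper limit the factor \<open>2\<close> of the reversal argument would lose information, so the
  terms \<open>j < m\<close> are paired with \<open>2 * m - j\<close> directly, leaving the midpoint \<open>j = m\<close> and the
  endpoint \<open>j = 2 * m\<close>.
\<close>

lemma power_sum_odd_double_cong:
  assumes "odd k"
  shows "[power_sum k (2 * m) = m ^ k] (mod (2 * m))"
proof (cases "m = 0")
  case True
  then show ?thesis using assms by (simp add: power_sum_def odd_pos)
next
  case False
  have "(\<Sum>j=1..2*m. j ^ k) = (\<Sum>j=1..<m. j ^ k) + m ^ k + (\<Sum>j=m+1..<2*m. j ^ k) + (2 * m) ^ k"
  proof -
    have "{1..2*m} = {1..<m} \<union> {m} \<union> {m+1..<2*m} \<union> {2*m}" using False by auto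
    then show ?thesis using False by (simp add: sum.union_disjoint[symmetric] Un_assoc)
  qed
  also have "(\<Sum>j=m+1..<2*m. j ^ k) = (\<Sum>j=1..<m. (2 * m - j) ^ k)"
    by (rule sum.reindex_bij_witness[of _ "\<lambda>j. 2 * m - j" "\<lambda>j. 2 * m - j"]) auto
  finally have eq: "power_sum k (2 * m) = m ^ k + ((\<Sum>j=1..<m. j ^ k + (2 * m - j) ^ k) + (2 * m) ^ k)"
    by (simp add: power_sum_def sum.distrib)
  have "2 * m dvd (\<Sum>j=1..<m. j ^ k + (2 * m - j) ^ k)"
  proof (rule dvd_sum)
    fix j assume "j \<in> {1..<m}"
    then show "2 * m dvd j ^ k + (2 * m - j) ^ k"
      using odd_power_add_dvd[OF assms, of j "2 * m - j"] by simp
  qed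
  moreover have "2 * m dvd (2 * m) ^ k" using assms by (intro dvd_power) (simp add: odd_pos)
  ultimately have "2 * m dvd (\<Sum>j=1..<m. j ^ k + (2 * m - j) ^ k) + (2 * m) ^ k"
    by (rule dvd_add)
  then show ?thesis unfolding eq by (auto simp: cong_def elim!: dvdE)
qed

text \<open>
  For \<open>n = 2 * m\<close> the question is whether \<open>2 * m\<close> divides \<open>m ^ k\<close>. For even \<open>m\<close>,
  \<open>2 * m\<close> divides already \<open>m\<^sup>2\<close>, whence the exception for \<open>k = 1\<close>; for odd \<open>m\<close>, parity forbids it.
\<close>

lemma dvd_power_sum_odd_iff:
  assumes "odd k" and "k = 1 \<Longrightarrow> \<not> 4 dvd n"
  shows "n dvd power_sum k n \<longleftrightarrow> \<not> [n = 2] (mod 4)"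
proof (cases "odd n")
  case True
  moreover have "\<not> [n = 2] (mod 4)" using True by (auto simp: cong_def) presburger
  ultimately show ?thesis using odd_dvd_power_sum_odd assms by blast
next
  case False
  then obtain m where m: "n = 2 * m" by auto
  have iff: "n dvd power_sum k n \<longleftrightarrow> 2 * m dvd m ^ k"
    using cong_dvd_iff[OF power_sum_odd_double_cong[OF assms(1), of m]] by (simp add: m)
  show ?thesis
  proof (cases "even m")
    case True
    then have "4 dvd n" by (auto simp: m)
    then have "k \<noteq> 0" "k \<noteq> 1" using assms odd_pos by blast+
    then have "k \<ge> 2" by simp
    then have "m ^ 2 dvd m ^ k" by (rule le_imp_power_dvd)
    moreover have "2 * m dvd m ^ 2" using True by (simp add: power2_eq_square)
    moreover have "\<not> [n = 2] (mod 4)" using \<open>4 dvd n\<close> by (auto simp: cong_def)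
    ultimately show ?thesis using iff dvd_trans by blast
  next
    case False
    then have "odd (m ^ k)" by simp
    then have "\<not> 2 * m dvd m ^ k" by (meson dvd_mult_left)
    moreover have "[n = 2] (mod 4)" using False m unfolding cong_def by presburger
    ultimately show ?thesis using iff by blast
  qed
qed

section \<open>The progressions as solution sets of congruences\<close>

lemma Xi_congruences_solvable:
  assumes "0 < a" and "p \<in> P_set a b"
  shows "\<exists>x::nat. 0 < x \<and> [x = 0] (mod (a * p)) \<and> [int x = - b] (mod int (p - 1))"
proof -
  have p: "prime p" and "gcd (int (a * p)) (int (p - 1)) dvd - b"
    using assms by (auto simp: P_set_def cong_0_iff simp del: of_nat_mult)
  then obtain y where y: "[int (a * p) * y = - b] (mod int (p - 1))"
    using cong_solve_dvd_int by blast
  have p1: "p - 1 > 0" using p prime_gt_1_nat by fastforce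
  \<comment> \<open>Adding \<open>p - 1\<close> to the residue of \<open>y\<close> keeps the solution positive.\<close>
  define z where "z = nat (y mod int (p - 1)) + (p - 1)"
  have "int z = y mod int (p - 1) + int (p - 1)" using p1 by (simp add: z_def)
  then have "[int z = y] (mod int (p - 1))" by (simp add: cong_def)
  then have "[int (a * p) * int z = int (a * p) * y] (mod int (p - 1))" by (rule cong_scalar_left)
  then have "[int (a * p * z) = - b] (mod int (p - 1))" using y cong_trans by fastforce
  moreover have "0 < a * p * z" using p1 assms p by (simp add: z_def prime_gt_0_nat)
  ultimately show ?thesis by (intro exI[of _ "a * p * z"]) (simp add: cong_0_iff)
qed

text \<open>
  The substitution \<open>x = a * n\<close> turns the divisibility conditions on \<open>n\<close> into the congruences in the
  definition of \<open>Xi\<close>. Their positive solutions are the least one plus the multiples of the lcm of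
  the moduli, and all of them are multiples of \<open>a\<close>, so that division by \<open>a\<close> yields integers.
\<close>

lemma Xi_progression_eq_solutions:
  assumes "0 < a" and "p \<in> P_set a b"
  shows "Xi_progression a b p =
    real ` {n. 0 < n \<and> p dvd n \<and> int (p - 1) dvd int a * int n + b}"
proof -
  define Q where "Q x \<longleftrightarrow> 0 < x \<and> [x = 0] (mod (a * p)) \<and> [int x = - b] (mod int (p - 1))" for x :: nat
  define x0 where "x0 = (LEAST x. Q x)"
  define L where "L = lcm (a * p) (p - 1)"
  have least: "x0 \<le> x" if "Q x" for x
    unfolding x0_def using that by (rule Least_le)
  have "Q x0"
    using Xi_congruences_solvable[OF assms] LeastI_ex[of Q] unfolding x0_def Q_def by blast
  have Q_scale: "Q (a * n) \<longleftrightarrow> 0 < n \<and> p dvd n \<and> int (p - 1) dvd int a * int n + b" for n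
    using assms by (simp add: Q_def cong_0_iff cong_iff_dvd_diff)
  have step: "Q (x0 + s * L)" for s
  proof -
    have "a * p dvd s * L" "p - 1 dvd s * L" by (auto simp: L_def)
    then have "[x0 + s * L = x0] (mod (a * p))" "[x0 + s * L = x0] (mod (p - 1))"
      by (simp_all add: cong_add_lcancel_0_nat cong_0_iff)
    then show ?thesis using \<open>Q x0\<close> unfolding Q_def
      by (metis cong_int_iff cong_trans add_gr_0)
  qed
  have Q_char: "Q x \<longleftrightarrow> (\<exists>s. x = x0 + s * L)" for x
  proof
    assume "Q x"
    then have "x0 \<le> x" by (rule least)
    have "[x = x0] (mod (a * p))" "[x = x0] (mod (p - 1))"
      using \<open>Q x\<close> \<open>Q x0\<close> unfolding Q_def by (meson cong_int_iff cong_trans cong_sym)+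
    then have "[x = x0] (mod L)" unfolding L_def by (rule cong_cong_lcm_nat)
    then show "\<exists>s. x = x0 + s * L" using cong_le_nat[OF \<open>x0 \<le> x\<close>] by (metis add.commute)
  qed (use step in auto)
  have "Xi a b p = real x0 / real a"
    by (simp add: Xi_def x0_def Q_def divide_inverse mult.commute)
  then have "Xi a b p + real s / real a * real L = real (x0 + s * L) / real a" for s
    by (simp add: add_divide_distrib)
  then have "Xi_progression a b p = {real x / real a | x. Q x}"
    unfolding Xi_progression_def L_def[symmetric] Q_char by (simp only:) blast
  also have "\<dots> = real ` {n. Q (a * n)}"
  proof safe
    fix x assume "Q x"
    then obtain n where "x = a * n" unfolding Q_def cong_0_iff by (metis dvd_mult_left dvdE)
    then show "real x / real a \<in> real ` {n. Q (a * n)}" using assms(1) \<open>Q x\<close> by auto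
  next
    fix n assume "Q (a * n)"
    then show "\<exists>x. real n = real x / real a \<and> Q x"
      using assms(1) by (intro exI[of _ "a * n"]) simp
  qed
  finally show ?thesis by (simp only: Q_scale)
qed

text \<open>
  An odd prime outside \<open>P_set a b\<close> adds nothing on the right: if \<open>p\<close> divides \<open>n\<close> and \<open>p - 1\<close> divides
  \<open>a * n + b\<close>, then the gcd of \<open>a * p\<close> and \<open>p - 1\<close> divides both \<open>a * n\<close> and \<open>a * n + b\<close>, hence \<open>b\<close>.
\<close>

lemma Union_Xi_progression_eq:
  assumes "0 < a"
  shows "(\<Union>p\<in>P_set a b. Xi_progression a b p) =
    real ` {n. 0 < n \<and> (\<exists>p. prime p \<and> odd p \<and> p dvd n \<and> int (p - 1) dvd int a * int n + b)}"
proof -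
  have "p \<in> P_set a b"
    if p: "prime p" "odd p" "p dvd n" "int (p - 1) dvd int a * int n + b" for p n
  proof -
    define d where "d = int (gcd (a * p) (p - 1))"
    have "d dvd int (a * p)" "d dvd int (p - 1)" by (auto simp: d_def simp del: of_nat_mult)
    moreover have "int (a * p) dvd int a * int n"
      using p(3) by (auto intro: mult_dvd_mono)
    ultimately have "d dvd int a * int n" "d dvd int a * int n + b"
      using p(4) dvd_trans by blast+
    then have "d dvd b" by (simp add: dvd_add_right_iff)
    then show ?thesis using p by (simp add: P_set_def d_def cong_0_iff)
  qed
  then have "{n. 0 < n \<and> (\<exists>p. prime p \<and> odd p \<and> p dvd n \<and> int (p - 1) dvd int a * int n + b)} =
      (\<Union>p\<in>P_set a b. {n. 0 < n \<and> p dvd n \<and> int (p - 1) dvd int a * int n + b})"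
    by (auto simp: P_set_def)
  then show ?thesis using Xi_progression_eq_solutions[OF assms] by (simp add: image_UN)
qed

section \<open>Exponents in arithmetic progression\<close>

theorem theorem3:
  fixes a :: nat and b :: int
  assumes "0 < a"
    and "\<And>n::nat. 0 < n \<Longrightarrow> 0 \<le> int a * int n + b"
  shows "(even a \<and> even b \<longrightarrow>
           real ` ({n. 0 < n} - M_set (lin_fun a b)) =
           real ` {n. 0 < n \<and> even n} \<union> (\<Union>p\<in>P_set a b. Xi_progression a b p)) \<and>
         (odd a \<and> odd b \<longrightarrow>
           real ` ({n. 0 < n} - M_set (lin_fun a b)) =
           real ` {n. 0 < n \<and> [n = 2] (mod 4)} \<union> (\<Union>p\<in>P_set a b. Xi_progression a b p)) \<and>
         (even a \<and> odd b \<longrightarrow>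
           {n. 0 < n} - M_set (lin_fun a b) = {n. 0 < n \<and> [n = 2] (mod 4)}) \<and>
         (odd a \<and> even b \<longrightarrow>
           {n. 0 < n} - M_set (lin_fun a b) = {n. 0 < n \<and> even n})"
proof -
  define R where "R n \<longleftrightarrow> (\<exists>p. prime p \<and> odd p \<and> p dvd n \<and> int (p - 1) dvd int a * int n + b)" for n
  have lin_eq: "int (lin_fun a b n) = int a * int n + b" if "0 < n" for n
    using assms(2)[OF that] by (simp add: lin_fun_def)
  have parity: "even (lin_fun a b n) \<longleftrightarrow> even (int a * int n + b)" if "0 < n" for n
    using lin_eq[OF that] by (metis even_of_nat)
  \<comment> \<open>This bound keeps exponent \<open>0\<close> away from \<open>n > 1\<close>
    and exponent \<open>1\<close> away from multiples of \<open>4\<close>.\<close>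
  have growth: "lin_fun a b n \<ge> n - 1" if "0 < n" for n
  proof -
    have "int a * int n + b = int a * (int n - 1) + (int a * int 1 + b)" by (simp add: algebra_simps)
    moreover have "int a * (int n - 1) \<ge> int n - 1" using assms(1) that by (simp add: mult_le_cancel_right1)
    ultimately show ?thesis using assms(2)[of 1] lin_eq[OF that] by linarith
  qed
  have even_case: "\<not> n dvd power_sum (lin_fun a b n) n \<longleftrightarrow> even n \<or> R n"
    if "0 < n" "even (lin_fun a b n)" for n
  proof (cases "lin_fun a b n = 0")
    case True
    then have "n = 1" using growth[OF that(1)] that(1) by simp
    then show ?thesis by (auto simp: R_def)
  next
    case False
    have "(p - 1) dvd lin_fun a b n \<longleftrightarrow> int (p - 1) dvd int a * int n + b" for p
      using lin_eq[OF that(1)] by (metis int_dvd_int_iff)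
    then have "\<not> n dvd power_sum (lin_fun a b n) n \<longleftrightarrow>
        (\<exists>p. prime p \<and> p dvd n \<and> int (p - 1) dvd int a * int n + b)"
      using dvd_power_sum_even_iff[OF that(1) _ that(2)] False by auto
    also have "\<dots> \<longleftrightarrow> even n \<or> R n"
    proof
      assume "\<exists>p. prime p \<and> p dvd n \<and> int (p - 1) dvd int a * int n + b"
      then obtain p where p: "prime p" "p dvd n" "int (p - 1) dvd int a * int n + b" by blast
      then have "p = 2 \<or> odd p" using prime_odd_nat[of p] prime_ge_2_nat[of p] by linarith
      then show "even n \<or> R n" using p unfolding R_def by blast
    next
      \<comment> \<open>The prime \<open>2\<close> imposes no condition on the exponent, since \<open>2 - 1\<close> divides everything.\<close>
      have "int (2 - 1) dvd int a * int n + b" by simp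
      moreover assume "even n \<or> R n"
      ultimately show "\<exists>p. prime p \<and> p dvd n \<and> int (p - 1) dvd int a * int n + b"
        unfolding R_def using two_is_prime_nat by blast
    qed
    finally show ?thesis .
  qed
  have odd_case: "\<not> n dvd power_sum (lin_fun a b n) n \<longleftrightarrow> [n = 2] (mod 4)"
    if "0 < n" "odd (lin_fun a b n)" for n
  proof -
    have "\<not> 4 dvd n" if "lin_fun a b n = 1"
      using growth[OF \<open>0 < n\<close>] that \<open>0 < n\<close> by (auto elim!: dvdE)
    then show ?thesis using dvd_power_sum_odd_iff that by blast
  qed
  have R_even: "even (int a * int n + b)" if "R n" for n
  proof -
    obtain p where p: "odd p" "int (p - 1) dvd int a * int n + b" using \<open>R n\<close> R_def by blast
    then have "even (int (p - 1))" by simp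
    then show ?thesis using p(2) by (rule dvd_trans)
  qed
  have not_M: "{n. 0 < n} - M_set (lin_fun a b) = {n. 0 < n \<and> \<not> n dvd power_sum (lin_fun a b n) n}"
    by (auto simp: M_set_def)
  have two_even: "even n" if "[n = 2] (mod 4)" for n :: nat
    using that unfolding cong_def by presburger
  have union: "(\<Union>p\<in>P_set a b. Xi_progression a b p) = real ` {n. 0 < n \<and> R n}"
    unfolding R_def by (rule Union_Xi_progression_eq[OF assms(1)])
  have "{n. 0 < n \<and> \<not> n dvd power_sum (lin_fun a b n) n} =
      {n. 0 < n \<and> even n} \<union> {n. 0 < n \<and> R n}" if "even a" "even b"
    using even_case parity that by auto
  moreover have "{n. 0 < n \<and> \<not> n dvd power_sum (lin_fun a b n) n} =
      {n. 0 < n \<and> [n = 2] (mod 4)} \<union> {n. 0 < n \<and> R n}" if ab: "odd a" "odd b"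
  proof -
    have "\<not> n dvd power_sum (lin_fun a b n) n \<longleftrightarrow> [n = 2] (mod 4) \<or> R n" if "0 < n" for n
    proof (cases "even n")
      case True
      then have "odd (lin_fun a b n)" "\<not> R n" using ab parity[OF that] R_even[of n] by auto
      then show ?thesis using odd_case[OF that] by simp
    next
      case False
      then have "even (lin_fun a b n)" using ab parity[OF that] by simp
      then show ?thesis using even_case[OF that] False two_even by blast
    qed
    then show ?thesis by blast
  qed
  moreover have "{n. 0 < n \<and> \<not> n dvd power_sum (lin_fun a b n) n} =
      {n. 0 < n \<and> [n = 2] (mod 4)}" if "even a" "odd b"
    using odd_case parity that by auto
  moreover have "{n. 0 < n \<and> \<not> n dvd power_sum (lin_fun a b n) n} =
      {n. 0 < n \<and> even n}" if ab: "odd a" "even b"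
  proof -
    have "\<not> n dvd power_sum (lin_fun a b n) n \<longleftrightarrow> even n" if "0 < n" for n
    proof (cases "even n")
      case True
      then show ?thesis using ab parity[OF that] even_case[OF that] by simp
    next
      case False
      then have "odd (lin_fun a b n)" using ab parity[OF that] by simp
      then show ?thesis using odd_case[OF that] False two_even by blast
    qed
    then show ?thesis by blast
  qed
  ultimately show ?thesis by (simp add: not_M union image_Un)
qed

end
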